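(* Let $F=F(r,p,X):\mathbb{R}\times\mathbb{R}^N\times\mathbb{S}^N\to\mathbb{R}$ (no dependence on $x$) satisfy (F1), (F2) and (F5). Let $U$ be an open subset of $\mathbb{R}^N$, and assume that $U$ satisfies (G$_F$). Then there exists a viscosity supersolution $v\in C(\mathbb{R}^N)$ of $F(v,Dv,D^2v)=0$ in $\mathbb{R}^N$ such that $v\ge 0$ in $\mathbb{R}^N$ and $U=\{x\in\mathbb{R}^N : v(x)>0\}$.
   Context: $\mathbb{S}^N$ is the space of real symmetric $N\times N$ matrices with its usual order. Hypotheses on $F$: (F1) $F$ is continuous. (F2) $F(r,p,X)\le F(r,p,Y)$ whenever $X\le Y$. (F5) $F(r,p,X)\le F(0,p,X)$ whenever $r\ge 0$. Condition (G$_F$) for an open set $U\subset\mathbb{R}^N$: if $\phi\in C^2(\mathbb{R}^N)$, $\hat x\in\mathbb{R}^N\setminus U$ and $\phi\le\phi(\hat x)=0$ in $\mathbb{R}^N\setminus U$, then $F(\phi(\hat x),D\phi(\hat x),D^2\phi(\hat x))\le 0$. A function $v\in C(\mathbb{R}^N)$ is a (viscosity) supersolution of $F(v,Dv,D^2v)=0$ in $\mathbb{R}^N$ if, whenever $\phi\in C^2(\mathbb{R}^N)$ and $v-\phi$ has a local minimum at $\hat x\in\mathbb{R}^N$, one has $F(v(\hat x),D\phi(\hat x),D^2\phi(\hat x))\le 0$.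
   Formalization: For U = R^N, where (G_F) is vacuous and the claim fails (e.g. F ≡ 1 has no supersolution), the formal statement additionally assumes F(0,0,0) ≤ 0; for every U different from R^N nothing is added. *)

theory Defs
  imports "HOL-Analysis.Analysis"
begin

definition sym_matrices :: "(real^'n^'n) set"
  where "sym_matrices = {X. transpose X = X}"

text \<open>The usual order of symmetric matrices, i.e. the order of their quadratic forms. It is
  meaningful for members of \<^const>\<open>sym_matrices\<close> only.\<close>
definition sym_le :: "real^'n^'n \<Rightarrow> real^'n^'n \<Rightarrow> bool"
  where "sym_le X Y \<longleftrightarrow> (\<forall>\<xi>. \<xi> \<bullet> (X *v \<xi>) \<le> \<xi> \<bullet> (Y *v \<xi>))"

text \<open>The gradient at a point where the function is not differentiable, and likewise the Hessian
  at a point where the gradient is not differentiable, is unspecified; both are only used for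
  functions satisfying \<open>C2\<close> below.\<close>
definition gradient :: "(real^'n \<Rightarrow> real) \<Rightarrow> real^'n \<Rightarrow> real^'n"
  where "gradient \<phi> x = (THE D. GDERIV \<phi> x :> D)"

definition hessian :: "(real^'n \<Rightarrow> real) \<Rightarrow> real^'n \<Rightarrow> real^'n^'n"
  where "hessian \<phi> x = jacobian (gradient \<phi>) (at x)"

definition C2 :: "(real^'n \<Rightarrow> real) \<Rightarrow> bool"
  where "C2 \<phi> \<longleftrightarrow> (\<forall>x. \<phi> differentiable (at x)) \<and>
    (\<forall>x. gradient \<phi> differentiable (at x)) \<and> continuous_on UNIV (hessian \<phi>)"

text \<open>Operators on \<open>\<real> \<times> \<real>\<^sup>N \<times> \<S>\<^sup>N\<close> are represented by functions of arbitrary square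
  matrices. Only their values at symmetric matrices matter, since the Hessian of a function
  of class \<open>C\<^sup>2\<close> is symmetric.\<close>

definition condition_G ::
  "(real \<Rightarrow> real^'n \<Rightarrow> real^'n^'n \<Rightarrow> real) \<Rightarrow> (real^'n) set \<Rightarrow> bool"
  where "condition_G F U \<longleftrightarrow>
    (\<forall>\<phi> x. C2 \<phi> \<longrightarrow> x \<in> - U \<longrightarrow> \<phi> x = 0 \<longrightarrow> (\<forall>y\<in>- U. \<phi> y \<le> \<phi> x) \<longrightarrow>
      F (\<phi> x) (gradient \<phi> x) (hessian \<phi> x) \<le> 0)"

definition viscosity_supersolution ::
  "(real \<Rightarrow> real^'n \<Rightarrow> real^'n^'n \<Rightarrow> real) \<Rightarrow> (real^'n \<Rightarrow> real) \<Rightarrow> bool"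
  where "viscosity_supersolution F v \<longleftrightarrow> continuous_on UNIV v \<and>
    (\<forall>\<phi> x. C2 \<phi> \<longrightarrow> (\<forall>\<^sub>F y in nhds x. v x - \<phi> x \<le> v y - \<phi> y) \<longrightarrow>
      F (v x) (gradient \<phi> x) (hessian \<phi> x) \<le> 0)"

end

theory Submission
  imports Defs
begin

text \<open>
  The distance function to the complement of \<open>U\<close> is the required supersolution. If a test function
  touches it from below at \<open>x\<close> and \<open>y\<close> is a nearest point to \<open>x\<close> outside \<open>U\<close>, then the
  test function translated by \<open>x - y\<close> and shifted by a constant has a local maximum with value \<open>0\<close>
  relative to the complement of \<open>U\<close> at \<open>y\<close>, because translating by \<open>x - y\<close> changes the distance by at most
  \<open>dist x y\<close>. Multiplication with a cutoff function makes this maximum global without changing the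
  derivatives at \<open>y\<close>, so that (G) and (F5) apply. If \<open>U\<close> is the whole space, the constant \<open>1\<close> works.
\<close>

section \<open>Calculus of gradients and Hessians\<close>

lemma GDERIV_imp_gradient:
  assumes "GDERIV f x :> D"
  shows "gradient f x = D"
  unfolding gradient_def
proof (rule the_equality)
  fix E assume "GDERIV f x :> E"
  with assms have "(\<lambda>h. h \<bullet> E) = (\<lambda>h. h \<bullet> D)"
    unfolding gderiv_def by (rule has_derivative_unique[rotated])
  then show "E = D"
    by (simp add: fun_eq_iff vector_eq_ldot)
qed (fact assms)

lemma differentiable_imp_GDERIV:
  assumes "f differentiable (at x)"
  shows "GDERIV f x :> gradient f x"
proof -
  obtain f' where f': "(f has_derivative f') (at x)"
    using assms unfolding differentiable_def by blast
  then interpret bounded_linear f' by (rule has_derivative_bounded_linear)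
  \<comment> \<open>Riesz representation: \<open>f'\<close> maps into the reals, so
    \<open>f' h = f' h * 1 = h \<bullet> adjoint f' 1\<close>.\<close>
  define D where "D = adjoint f' 1"
  have "f' = (\<lambda>h. h \<bullet> D)"
    unfolding D_def using adjoint_works[OF linear_axioms, of _ 1] by (simp add: fun_eq_iff)
  with f' have "GDERIV f x :> D"
    unfolding gderiv_def by simp
  then show ?thesis
    using GDERIV_imp_gradient[OF \<open>GDERIV f x :> D\<close>] by simp
qed

lemma C2_GDERIV: "C2 f \<Longrightarrow> GDERIV f x :> gradient f x"
  by (simp add: C2_def differentiable_imp_GDERIV)

lemma C2_has_derivative_gradient:
  "C2 f \<Longrightarrow> (gradient f has_derivative (\<lambda>h. hessian f x *v h)) (at x)"
  unfolding C2_def hessian_def by (simp add: jacobian_works[symmetric])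

lemma C2_continuous_hessian: "C2 f \<Longrightarrow> continuous_on UNIV (hessian f)"
  by (simp add: C2_def)

lemma C2_continuous_gradient: "C2 f \<Longrightarrow> continuous_on UNIV (gradient f)"
  by (simp add: C2_def differentiable_imp_continuous_on differentiable_at_imp_differentiable_on)

lemma C2_continuous: "C2 f \<Longrightarrow> continuous_on UNIV f"
  by (simp add: C2_def differentiable_imp_continuous_on differentiable_at_imp_differentiable_on)

text \<open>Derivatives are unique, so exhibiting candidates \<open>g\<close> and \<open>H\<close>
  determines \<open>gradient\<close> and \<open>hessian\<close> as functions. The test functions
  built below get their regularity and their derivative formulas from this single rule.\<close>

lemma C2I:
  assumes g: "\<And>x. GDERIV f x :> g x"
    and H: "\<And>x. (g has_derivative (\<lambda>h. H x *v h)) (at x)"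
    and cont: "continuous_on UNIV H"
  shows "C2 f" and "gradient f = g" and "hessian f = H"
proof -
  show grad: "gradient f = g"
    using GDERIV_imp_gradient[OF g] by (rule ext)
  show hess: "hessian f = H"
  proof
    fix x
    show "hessian f x = H x"
      unfolding hessian_def jacobian_def grad frechet_derivative_at[OF H, symmetric] by simp
  qed
  show "C2 f"
    unfolding C2_def hess grad differentiable_def
    using g[unfolded gderiv_def] H cont by (intro conjI allI exI)
qed

text \<open>The rank-one matrix of \<open>p\<close> times the transpose of \<open>q\<close>; it
  supplies the terms of second derivatives that pair two gradients.\<close>

definition outer :: "real^'n \<Rightarrow> real^'n \<Rightarrow> real^'n^'n"
  where "outer p q = (\<chi> i j. p $ i * q $ j)"

lemma outer_mult_vec: "outer p q *v h = (q \<bullet> h) *\<^sub>R p"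
  by (simp add: outer_def matrix_vector_mult_def vec_eq_iff inner_vec_def sum_distrib_left
      sum_distrib_right algebra_simps)

lemma outer_zero [simp]: "outer 0 q = 0" "outer p 0 = 0"
  by (simp_all add: outer_def vec_eq_iff)

lemma continuous_on_outer [continuous_intros]:
  "continuous_on S p \<Longrightarrow> continuous_on S q \<Longrightarrow> continuous_on S (\<lambda>x. outer (p x) (q x))"
  unfolding outer_def by (intro continuous_intros)

text \<open>The explicit formulas serve the localization of (G): where \<open>f\<close> equals 1
  with zero gradient and \<open>g\<close> vanishes, \<open>D\<close> and \<open>H\<close> reduce to
  the gradient and Hessian of \<open>g\<close>.\<close>

lemma C2_mult:
  assumes f: "C2 f" and g: "C2 g"
  defines "D \<equiv> \<lambda>x. f x *\<^sub>R gradient g x + g x *\<^sub>R gradient f x"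
  defines "H \<equiv> \<lambda>x. f x *\<^sub>R hessian g x + g x *\<^sub>R hessian f x
    + outer (gradient g x) (gradient f x) + outer (gradient f x) (gradient g x)"
  shows "C2 (\<lambda>x. f x * g x)" and "gradient (\<lambda>x. f x * g x) = D" and "hessian (\<lambda>x. f x * g x) = H"
proof -
  have 1: "GDERIV (\<lambda>x. f x * g x) x :> D x" for x
    unfolding D_def by (intro GDERIV_mult C2_GDERIV f g)
  note df = C2_GDERIV[OF f, unfolded gderiv_def] and dg = C2_GDERIV[OF g, unfolded gderiv_def]
  have 2: "(D has_derivative (\<lambda>h. H x *v h)) (at x)" for x
    unfolding D_def H_def
    by (rule derivative_eq_intros df dg C2_has_derivative_gradient f g refl)+
      (simp add: fun_eq_iff matrix_vector_mult_add_rdistrib outer_mult_vec inner_commute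
        scaleR_matrix_vector_assoc)
  have 3: "continuous_on UNIV H"
    unfolding H_def
    by (intro continuous_intros C2_continuous C2_continuous_gradient C2_continuous_hessian f g)
  from C2I[OF 1 2 3] show "C2 (\<lambda>x. f x * g x)" and "gradient (\<lambda>x. f x * g x) = D"
    and "hessian (\<lambda>x. f x * g x) = H" .
qed

lemma C2_compose:
  assumes q: "C2 q"
    and g: "\<And>t. DERIV g t :> g' t" and g': "\<And>t. DERIV g' t :> g'' t"
    and cont: "continuous_on UNIV g''"
  shows "C2 (\<lambda>x. g (q x))" and "gradient (\<lambda>x. g (q x)) = (\<lambda>x. g' (q x) *\<^sub>R gradient q x)"
proof -
  define D where "D x = g' (q x) *\<^sub>R gradient q x" for x
  define H where
    "H x = g' (q x) *\<^sub>R hessian q x + g'' (q x) *\<^sub>R outer (gradient q x) (gradient q x)" for x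
  have 1: "GDERIV (\<lambda>x. g (q x)) x :> D x" for x
    unfolding D_def by (intro GDERIV_DERIV_compose C2_GDERIV q g)
  \<comment> \<open>A second chain rule, for the scalar factor of \<open>D\<close>; it produces the
    rank-one term of \<open>H\<close>.\<close>
  have "GDERIV (\<lambda>x. g' (q x)) x :> g'' (q x) *\<^sub>R gradient q x" for x
    by (intro GDERIV_DERIV_compose C2_GDERIV q g')
  then have dg': "((\<lambda>x. g' (q x)) has_derivative (\<lambda>h. h \<bullet> (g'' (q x) *\<^sub>R gradient q x))) (at x)" for x
    unfolding gderiv_def .
  have 2: "(D has_derivative (\<lambda>h. H x *v h)) (at x)" for x
    unfolding D_def H_def
    by (rule derivative_eq_intros dg' C2_has_derivative_gradient q refl)+
      (simp add: fun_eq_iff matrix_vector_mult_add_rdistrib outer_mult_vec inner_commute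
        scaleR_matrix_vector_assoc[symmetric])
  have contg': "continuous_on UNIV g'"
    using DERIV_isCont[OF g'] by (simp add: continuous_at_imp_continuous_on)
  have 3: "continuous_on UNIV H"
    unfolding H_def
    by (intro continuous_intros C2_continuous_gradient C2_continuous_hessian q
        continuous_on_compose2[OF cont] continuous_on_compose2[OF contg'] C2_continuous) auto
  show "C2 (\<lambda>x. g (q x))" and "gradient (\<lambda>x. g (q x)) = (\<lambda>x. g' (q x) *\<^sub>R gradient q x)"
    using C2I[OF 1 2 3] D_def by auto
qed

lemma C2_translate:
  assumes f: "C2 f"
  shows "C2 (\<lambda>x. f (x + a) - c)" and "gradient (\<lambda>x. f (x + a) - c) = (\<lambda>x. gradient f (x + a))"
    and "hessian (\<lambda>x. f (x + a) - c) = (\<lambda>x. hessian f (x + a))"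
proof -
  have t: "((\<lambda>x. x + a) has_derivative (\<lambda>h. h)) (at x)" for x
    by (auto intro!: derivative_eq_intros)
  have 1: "GDERIV (\<lambda>x. f (x + a) - c) x :> gradient f (x + a)" for x
    using has_derivative_diff[OF
        has_derivative_compose[OF t C2_GDERIV[OF f, unfolded gderiv_def]] has_derivative_const[of c]]
    unfolding gderiv_def by simp
  have 2: "((\<lambda>x. gradient f (x + a)) has_derivative (\<lambda>h. hessian f (x + a) *v h)) (at x)" for x
    by (rule has_derivative_compose[OF t C2_has_derivative_gradient[OF f]])
  have 3: "continuous_on UNIV (\<lambda>x. hessian f (x + a))"
    by (intro continuous_on_compose2[OF C2_continuous_hessian[OF f]] continuous_intros) auto
  from C2I[OF 1 2 3] show "C2 (\<lambda>x. f (x + a) - c)"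
    and "gradient (\<lambda>x. f (x + a) - c) = (\<lambda>x. gradient f (x + a))"
    and "hessian (\<lambda>x. f (x + a) - c) = (\<lambda>x. hessian f (x + a))" .
qed

lemma C2_along_line:
  assumes "C2 f"
  shows "((\<lambda>s. f (a + s *\<^sub>R v)) has_real_derivative gradient f (a + s *\<^sub>R v) \<bullet> v) (at s)"
proof -
  have "((\<lambda>s. a + s *\<^sub>R v) has_derivative (\<lambda>h. h *\<^sub>R v)) (at s)"
    by (auto intro!: derivative_eq_intros)
  from has_derivative_compose[OF this C2_GDERIV[OF assms, unfolded gderiv_def]]
  show ?thesis
    unfolding has_field_derivative_def
    by (simp add: inner_commute mult.commute[of _ "gradient f _ \<bullet> _"] mult_commute_abs)
qed

section \<open>Symmetry and sign of the Hessian\<close>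

text \<open>Both the second difference and the constant \<open>2 * (norm u + norm v)\<^sup>2\<close> are symmetric in \<open>u\<close>
  and \<open>v\<close>, so exchanging the two directions yields the symmetry of the Hessian.\<close>

lemma second_difference_hessian:
  assumes f: "C2 f" and e: "e > 0"
  shows "\<exists>d>0. \<forall>t. 0 < t \<and> t < d \<longrightarrow>
    \<bar>f (x + t *\<^sub>R u + t *\<^sub>R v) - f (x + t *\<^sub>R u) - f (x + t *\<^sub>R v) + f x - t\<^sup>2 * (v \<bullet> (hessian f x *v u))\<bar>
      \<le> e * t\<^sup>2 * (2 * (norm u + norm v)\<^sup>2)"
proof -
  define C where "C = norm u + norm v"
  define G where "G = gradient f"
  \<comment> \<open>Remainder of the first-order expansion of the gradient, of order
    \<open>o(norm w)\<close> by differentiability at \<open>x\<close>.\<close>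
  define R where "R w = G (x + w) - G x - hessian f x *v w" for w
  obtain d0 where d0: "d0 > 0"
    and "\<And>y. norm (y - x) < d0 \<Longrightarrow> norm (G y - G x - hessian f x *v (y - x)) \<le> e * norm (y - x)"
    using C2_has_derivative_gradient[OF f, of x] e
    unfolding has_derivative_at_alt G_def by blast
  from this(2)[of "x + _"] have R: "norm w < d0 \<Longrightarrow> norm (R w) \<le> e * norm w" for w
    unfolding R_def by simp
  \<comment> \<open>Ensures \<open>t * C < d0\<close>, so that
    \<open>t *\<^sub>R u + s *\<^sub>R v\<close> and \<open>s *\<^sub>R v\<close> both lie where
    \<open>R\<close> is controlled; the summand 1 keeps the denominator positive.\<close>
  define d where "d = d0 / (C + 1)"
  have C: "C \<ge> 0" unfolding C_def by simp
  have "d > 0" unfolding d_def using d0 C by simp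
  moreover have
    "\<bar>f (x + t *\<^sub>R u + t *\<^sub>R v) - f (x + t *\<^sub>R u) - f (x + t *\<^sub>R v) + f x - t\<^sup>2 * (v \<bullet> (hessian f x *v u))\<bar>
      \<le> e * t\<^sup>2 * (2 * C\<^sup>2)" if t: "0 < t" "t < d" for t
  proof -
    have tC: "t * C < d0"
    proof -
      have "t * (C + 1) < d0"
        using t(2) C unfolding d_def by (simp add: pos_less_divide_eq)
      then show ?thesis using t(1) by (simp add: algebra_simps)
    qed
    \<comment> \<open>The second difference is \<open>K t - K 0\<close>, so one application of the
      mean value theorem turns it into a difference of two gradients.\<close>
    define K where "K s = f ((x + t *\<^sub>R u) + s *\<^sub>R v) - f (x + s *\<^sub>R v)" for s
    have K': "(K has_real_derivative (G ((x + t *\<^sub>R u) + s *\<^sub>R v) - G (x + s *\<^sub>R v)) \<bullet> v) (at s)" for s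
      unfolding K_def G_def inner_diff_left by (intro DERIV_diff C2_along_line f)
    obtain s where s: "0 < s" "s < t"
      and "K t - K 0 = (t - 0) * ((G ((x + t *\<^sub>R u) + s *\<^sub>R v) - G (x + s *\<^sub>R v)) \<bullet> v)"
      using MVT2[OF t(1), of K, OF K'] by blast
    \<comment> \<open>The linear contributions of \<open>s *\<^sub>R v\<close> cancel, so the
      unknown intermediate value \<open>s\<close> survives only inside the remainders.\<close>
    moreover have "G ((x + t *\<^sub>R u) + s *\<^sub>R v) - G (x + s *\<^sub>R v)
        = t *\<^sub>R (hessian f x *v u) + R (t *\<^sub>R u + s *\<^sub>R v) - R (s *\<^sub>R v)"
      unfolding R_def by (simp add: matrix_vector_right_distrib matrix_vector_mult_scaleR add.assoc)
    ultimately have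
      "K t - K 0 = t * ((t *\<^sub>R (hessian f x *v u) + R (t *\<^sub>R u + s *\<^sub>R v) - R (s *\<^sub>R v)) \<bullet> v)"
      by (simp only: diff_0_right)
    then have Kt: "K t - K 0 - t\<^sup>2 * (v \<bullet> (hessian f x *v u))
        = t * ((R (t *\<^sub>R u + s *\<^sub>R v) - R (s *\<^sub>R v)) \<bullet> v)"
      by (simp add: inner_diff_left inner_add_left inner_commute power2_eq_square algebra_simps)
    have "norm (s *\<^sub>R v) \<le> t * norm v"
      using s by (simp add: mult_right_mono)
    then have n1: "norm (t *\<^sub>R u + s *\<^sub>R v) \<le> t * C"
      using norm_triangle_ineq[of "t *\<^sub>R u" "s *\<^sub>R v"] t(1) by (simp add: C_def distrib_left)
    have n2: "norm (s *\<^sub>R v) \<le> t * C"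
      using \<open>norm (s *\<^sub>R v) \<le> t * norm v\<close> t(1) unfolding C_def
      by (smt (verit) mult_left_mono norm_ge_zero)
    have "norm (R w) \<le> e * (t * C)" if "norm w \<le> t * C" for w
      using R[of w] that tC e by (smt (verit) mult_left_mono)
    then have "norm (R (t *\<^sub>R u + s *\<^sub>R v) - R (s *\<^sub>R v)) \<le> 2 * (e * (t * C))"
      using n1 n2 norm_triangle_ineq4[of "R (t *\<^sub>R u + s *\<^sub>R v)" "R (s *\<^sub>R v)"] by (smt (verit))
    moreover have "norm v \<le> C" unfolding C_def by simp
    ultimately have "\<bar>(R (t *\<^sub>R u + s *\<^sub>R v) - R (s *\<^sub>R v)) \<bullet> v\<bar> \<le> 2 * (e * (t * C)) * C"
      using Cauchy_Schwarz_ineq2 by (meson mult_mono norm_ge_zero order_trans)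
    then have "t * \<bar>(R (t *\<^sub>R u + s *\<^sub>R v) - R (s *\<^sub>R v)) \<bullet> v\<bar> \<le> t * (2 * (e * (t * C)) * C)"
      using t(1) by (simp add: mult_left_mono)
    then have "\<bar>K t - K 0 - t\<^sup>2 * (v \<bullet> (hessian f x *v u))\<bar> \<le> e * t\<^sup>2 * (2 * C\<^sup>2)"
      unfolding Kt abs_mult using t(1) by (simp add: power2_eq_square algebra_simps)
    then show ?thesis unfolding K_def by (simp add: algebra_simps)
  qed
  ultimately show ?thesis unfolding C_def by blast
qed

lemma hessian_bilinear_symmetric:
  assumes f: "C2 f"
  shows "v \<bullet> (hessian f x *v u) = u \<bullet> (hessian f x *v v)"
proof (rule ccontr)
  define C where "C = 2 * (norm u + norm v)\<^sup>2"
  define a where "a = \<bar>v \<bullet> (hessian f x *v u) - u \<bullet> (hessian f x *v v)\<bar>"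
  assume "v \<bullet> (hessian f x *v u) \<noteq> u \<bullet> (hessian f x *v v)"
  then have a: "a > 0" unfolding a_def by simp
  have C: "C \<ge> 0" unfolding C_def by simp
  \<comment> \<open>Chosen so that the two errors \<open>e * t\<^sup>2 * C\<close> together stay
    below \<open>t\<^sup>2 * a\<close>: \<open>2 * e * C < e * (2 * C + 1) = a\<close>.\<close>
  define e where "e = a / (2 * C + 1)"
  have e: "e > 0" unfolding e_def using a C by simp
  obtain d where d: "d > 0"
    "\<And>t. 0 < t \<Longrightarrow> t < d \<Longrightarrow> \<bar>f (x + t *\<^sub>R u + t *\<^sub>R v) - f (x + t *\<^sub>R u) - f (x + t *\<^sub>R v) + f x
      - t\<^sup>2 * (v \<bullet> (hessian f x *v u))\<bar> \<le> e * t\<^sup>2 * C"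
    using second_difference_hessian[OF f e, of x u v] unfolding C_def by blast
  obtain d' where d': "d' > 0"
    "\<And>t. 0 < t \<Longrightarrow> t < d' \<Longrightarrow> \<bar>f (x + t *\<^sub>R v + t *\<^sub>R u) - f (x + t *\<^sub>R v) - f (x + t *\<^sub>R u) + f x
      - t\<^sup>2 * (u \<bullet> (hessian f x *v v))\<bar> \<le> e * t\<^sup>2 * C"
    using second_difference_hessian[OF f e, of x v u] unfolding C_def
    by (auto simp: add.commute)
  define t where "t = min d d' / 2"
  have t: "0 < t" "t < d" "t < d'" unfolding t_def using d(1) d'(1) by auto
  have "x + t *\<^sub>R v + t *\<^sub>R u = x + t *\<^sub>R u + t *\<^sub>R v" by (simp add: algebra_simps)
  with d(2)[OF t(1,2)] d'(2)[OF t(1,3)]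
  have "\<bar>t\<^sup>2 * (v \<bullet> (hessian f x *v u)) - t\<^sup>2 * (u \<bullet> (hessian f x *v v))\<bar> \<le> 2 * (e * t\<^sup>2 * C)"
    by simp
  then have "t\<^sup>2 * a \<le> t\<^sup>2 * (2 * e * C)"
    unfolding a_def right_diff_distrib[symmetric] abs_mult by (simp add: algebra_simps)
  then have "a \<le> 2 * e * C" using t(1) by simp
  moreover have "e * (2 * C + 1) = a"
    unfolding e_def using C by simp
  ultimately show False using e by (simp add: algebra_simps)
qed

text \<open>(F2) and (F5) are assumed for symmetric matrices only; this makes them applicable to
  Hessians of test functions.\<close>

lemma hessian_symmetric:
  assumes f: "C2 f"
  shows "hessian f x \<in> sym_matrices"
proof -
  have "(transpose (hessian f x) *v u) \<bullet> v = (hessian f x *v u) \<bullet> v" for u v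
    unfolding transpose_matrix_vector dot_lmul_matrix
    using hessian_bilinear_symmetric[OF f, of u x v] by (simp add: inner_commute)
  then have "transpose (hessian f x) *v u = hessian f x *v u" for u
    by (rule vector_eq_rdot[THEN iffD1, OF allI])
  then have "transpose (hessian f x) = hessian f x"
    by (simp add: matrix_eq)
  then show ?thesis by (simp add: sym_matrices_def)
qed

text \<open>If the quadratic form of the Hessian were positive in a direction \<open>\<xi>\<close>,
  the directional derivative, zero at \<open>x\<close>, would be positive shortly after
  \<open>x\<close> along \<open>\<xi>\<close>. By the mean value theorem \<open>f\<close> would then
  exceed \<open>f x\<close> arbitrarily close to \<open>x\<close>.\<close>

lemma local_max_gradient_hessian:
  assumes f: "C2 f" and max: "\<forall>\<^sub>F y in nhds x. f y \<le> f x"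
  shows "gradient f x = 0" and "sym_le (hessian f x) 0"
proof -
  obtain r where r: "r > 0" "\<And>y. dist y x < r \<Longrightarrow> f y \<le> f x"
    using max unfolding eventually_nhds_metric by blast
  have "(\<lambda>h. h \<bullet> gradient f x) = (\<lambda>h. 0)"
    using C2_GDERIV[OF f, unfolded gderiv_def] r
    by (intro differential_zero_maxmin[of x "ball x r" f]) (auto simp: dist_commute)
  then show grad: "gradient f x = 0"
    by (metis inner_eq_zero_iff)
  have "\<xi> \<bullet> (hessian f x *v \<xi>) \<le> 0" for \<xi>
  proof (rule ccontr)
    assume "\<not> \<xi> \<bullet> (hessian f x *v \<xi>) \<le> 0"
    then have pos: "(hessian f x *v \<xi>) \<bullet> \<xi> > 0" by (simp add: inner_commute)
    have "((\<lambda>s. x + s *\<^sub>R \<xi>) has_derivative (\<lambda>h. h *\<^sub>R \<xi>)) (at 0)"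
      by (auto intro!: derivative_eq_intros)
    from has_derivative_compose[OF this C2_has_derivative_gradient[OF f]]
    have "((\<lambda>s. gradient f (x + s *\<^sub>R \<xi>)) has_derivative (\<lambda>h. hessian f x *v (h *\<^sub>R \<xi>))) (at 0)"
      by simp
    then have "((\<lambda>s. gradient f (x + s *\<^sub>R \<xi>) \<bullet> \<xi>) has_derivative
        (\<lambda>h. (hessian f x *v (h *\<^sub>R \<xi>)) \<bullet> \<xi>)) (at 0)"
      by (rule has_derivative_inner_left)
    then have "((\<lambda>s. gradient f (x + s *\<^sub>R \<xi>) \<bullet> \<xi>) has_real_derivative (hessian f x *v \<xi>) \<bullet> \<xi>) (at 0)"
      unfolding has_field_derivative_def
      by (simp add: matrix_vector_mult_scaleR mult_commute_abs)
    from DERIV_pos_inc_right[OF this pos] obtain d where d: "d > 0"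
      "\<And>h. 0 < h \<Longrightarrow> h < d \<Longrightarrow> 0 < gradient f (x + h *\<^sub>R \<xi>) \<bullet> \<xi>"
      by (auto simp: grad)
    have n: "norm \<xi> > 0" using pos by (cases "\<xi> = 0") auto
    obtain t where t: "0 < t" "t < d" "t < r / norm \<xi>"
      using dense[of 0 "min d (r / norm \<xi>)"] d(1) r(1) n by auto
    obtain s where "0 < s" "s < t"
      "f (x + t *\<^sub>R \<xi>) - f (x + 0 *\<^sub>R \<xi>) = (t - 0) * (gradient f (x + s *\<^sub>R \<xi>) \<bullet> \<xi>)"
      using MVT2[OF t(1), of "\<lambda>s. f (x + s *\<^sub>R \<xi>)", OF C2_along_line[OF f]] by blast
    with d(2)[of s] t have "f (x + t *\<^sub>R \<xi>) > f x"
      by (smt (verit) add.right_neutral mult_pos_pos scaleR_zero_left)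
    moreover have "dist (x + t *\<^sub>R \<xi>) x < r"
      using t n by (simp add: dist_norm pos_less_divide_eq)
    ultimately show False using r(2) by force
  qed
  then show "sym_le (hessian f x) 0" by (simp add: sym_le_def)
qed

section \<open>Localization of condition (G)\<close>

text \<open>With exponent at least 2 the two branches fit together at 0, where the difference
  quotient is dominated by \<open>\<bar>h\<bar> ^ (n + 1)\<close>. The instances
  \<open>n = 1\<close> and \<open>n = 0\<close> show that the cube of the positive part is twice
  continuously differentiable.\<close>

lemma DERIV_pos_part_power:
  "DERIV (\<lambda>t::real. (max 0 t) ^ (n + 2)) t :> real (n + 2) * (max 0 t) ^ (n + 1)"
proof -
  consider "t > 0" | "t < 0" | "t = 0" by linarith
  then show ?thesis
  proof cases
    case 1
    have "DERIV (\<lambda>t::real. t ^ (n + 2)) t :> real (n + 2) * (max 0 t) ^ (n + 1)"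
      using DERIV_pow[of "n + 2" t] 1 by simp
    then show ?thesis
      by (rule has_field_derivative_transform_within_open[of _ _ _ "{0<..}"]) (use 1 in auto)
  next
    case 2
    have "DERIV (\<lambda>t::real. 0) t :> real (n + 2) * (max 0 t) ^ (n + 1)"
      using 2 by (auto intro!: derivative_eq_intros)
    then show ?thesis
      by (rule has_field_derivative_transform_within_open[of _ _ _ "{..<0}"]) (use 2 in auto)
  next
    case 3
    have "((\<lambda>h::real. (max 0 h) ^ (n + 2) / h) \<longlongrightarrow> 0) (at 0)"
    proof (rule Lim_null_comparison)
      show "\<forall>\<^sub>F h::real in at 0. norm ((max 0 h) ^ (n + 2) / h) \<le> \<bar>h\<bar> ^ (n + 1)"
      proof (intro always_eventually allI)
        fix h :: real
        show "norm ((max 0 h) ^ (n + 2) / h) \<le> \<bar>h\<bar> ^ (n + 1)"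
        proof (cases "h > 0")
          \<comment> \<open>This includes \<open>h = 0\<close>, where the quotient is 0 by the
            convention for division by zero.\<close>
          case False
          then show ?thesis
            using zero_le_power[of "\<bar>h\<bar>" "n + 1"] by (simp del: power_Suc)
        qed simp
      qed
      have "((\<lambda>h::real. \<bar>h\<bar> ^ (n + 1)) \<longlongrightarrow> \<bar>0\<bar> ^ (n + 1)) (at 0)"
        by (intro tendsto_intros)
      then show "((\<lambda>h::real. \<bar>h\<bar> ^ (n + 1)) \<longlongrightarrow> 0) (at 0)" by simp
    qed
    then show ?thesis using 3 by (simp add: DERIV_def)
  qed
qed

lemma C2_one_minus_sqnorm:
  "C2 (\<lambda>x::real^'n. 1 - k * ((x - y) \<bullet> (x - y)))"
  "gradient (\<lambda>x::real^'n. 1 - k * ((x - y) \<bullet> (x - y))) = (\<lambda>x. (- 2 * k) *\<^sub>R (x - y))"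
proof -
  have 1: "GDERIV (\<lambda>x. 1 - k * ((x - y) \<bullet> (x - y))) x :> (- 2 * k) *\<^sub>R (x - y)" for x :: "real^'n"
    unfolding gderiv_def
    by (auto intro!: derivative_eq_intros simp: fun_eq_iff inner_commute algebra_simps)
  have 2: "((\<lambda>x. (- 2 * k) *\<^sub>R (x - y)) has_derivative (\<lambda>h. mat (- 2 * k) *v h)) (at x)"
    for x :: "real^'n"
  proof -
    have "mat c *v h = c *\<^sub>R h" for c :: real and h :: "real^'n"
      by (simp add: mat_def matrix_vector_mult_def vec_eq_iff if_distrib if_distribR cong: if_cong)
    then show ?thesis by (auto intro!: derivative_eq_intros)
  qed
  show "C2 (\<lambda>x::real^'n. 1 - k * ((x - y) \<bullet> (x - y)))"
    and "gradient (\<lambda>x::real^'n. 1 - k * ((x - y) \<bullet> (x - y))) = (\<lambda>x. (- 2 * k) *\<^sub>R (x - y))"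
    using C2I[OF 1 2 continuous_on_const] by blast+
qed

text \<open>The witness is the cube of the positive part of
  \<open>1 - (dist x y / r)\<^sup>2\<close>. The inner function is nonpositive outside the ball and
  critical at \<open>y\<close>, and cubing smooths the kink of the positive part enough for
  \<open>C2\<close>.\<close>

lemma C2_cutoff_exists:
  fixes y :: "real^'n"
  assumes r: "r > 0"
  obtains \<eta> where "C2 \<eta>" "\<eta> y = 1" "gradient \<eta> y = 0" "\<And>x. \<eta> x \<ge> 0"
    "\<And>x. dist x y \<ge> r \<Longrightarrow> \<eta> x = 0"
proof
  let ?q = "\<lambda>x. 1 - (1 / r\<^sup>2) * ((x - y) \<bullet> (x - y))"
  let ?\<eta> = "\<lambda>x. (max 0 (?q x)) ^ 3"
  have 1: "DERIV (\<lambda>t::real. (max 0 t) ^ 3) t :> 3 * (max 0 t)\<^sup>2" for t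
    using DERIV_pos_part_power[of 1 t] by (simp add: numeral_2_eq_2 numeral_3_eq_3)
  have 2: "DERIV (\<lambda>t::real. 3 * (max 0 t)\<^sup>2) t :> 3 * (2 * max 0 t)" for t
    using DERIV_cmult[OF DERIV_pos_part_power[of 0 t], of 3] by (simp add: numeral_2_eq_2)
  have 3: "continuous_on UNIV (\<lambda>t::real. 3 * (2 * max 0 t))"
    by (intro continuous_intros)
  note * = C2_compose[OF C2_one_minus_sqnorm(1) 1 2 3, of "1 / r\<^sup>2" y]
  show "C2 ?\<eta>" by (fact *(1))
  show "gradient ?\<eta> y = 0" unfolding *(2) C2_one_minus_sqnorm(2) by simp
  show "?\<eta> y = 1" by simp
  show "?\<eta> x \<ge> 0" for x by simp
  show "?\<eta> x = 0" if "dist x y \<ge> r" for x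
  proof -
    have "r\<^sup>2 \<le> (x - y) \<bullet> (x - y)"
      using that r by (metis dist_norm power2_norm_eq_inner power_mono less_imp_le)
    then have "?q x \<le> 0" using r by (simp add: divide_simps)
    then show ?thesis by simp
  qed
qed

text \<open>(G) compares values on the whole complement of \<open>U\<close>, whereas viscosity tests
  are local. The cutoff bridges this: a nonnegative factor preserves the sign of
  \<open>\<phi>\<close> inside the ball, and outside it the product is 0, exactly the maximal value
  (G) prescribes.\<close>

lemma condition_G_local:
  assumes G: "condition_G F U" and \<phi>: "C2 \<phi>" and y: "y \<notin> U" "\<phi> y = 0"
    and max: "\<forall>\<^sub>F z in nhds y. z \<notin> U \<longrightarrow> \<phi> z \<le> 0"
  shows "F 0 (gradient \<phi> y) (hessian \<phi> y) \<le> 0"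
proof -
  obtain r where r: "r > 0" "\<And>z. dist z y < r \<Longrightarrow> z \<notin> U \<Longrightarrow> \<phi> z \<le> 0"
    using max unfolding eventually_nhds_metric by blast
  obtain \<eta> where \<eta>: "C2 \<eta>" "\<eta> y = 1" "gradient \<eta> y = 0" "\<And>x. \<eta> x \<ge> 0"
    "\<And>x. dist x y \<ge> r \<Longrightarrow> \<eta> x = 0"
    using C2_cutoff_exists[OF r(1)] by blast
  note prod = C2_mult[OF \<eta>(1) \<phi>]
  have "\<eta> z * \<phi> z \<le> 0" if "z \<notin> U" for z
  proof (cases "dist z y < r")
    case True
    then show ?thesis using r(2) that \<eta>(4) by (simp add: mult_nonneg_nonpos)
  qed (simp add: \<eta>(5))
  moreover have "gradient (\<lambda>z. \<eta> z * \<phi> z) y = gradient \<phi> y"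
    and "hessian (\<lambda>z. \<eta> z * \<phi> z) y = hessian \<phi> y"
    unfolding prod(2,3) using y(2) \<eta>(2,3) by simp_all
  ultimately show ?thesis
    using G[unfolded condition_G_def, rule_format, OF prod(1), of y] y by simp
qed

section \<open>The distance function as a supersolution\<close>

lemma infdist_supersolution:
  fixes F :: "real \<Rightarrow> real^'n \<Rightarrow> real^'n^'n \<Rightarrow> real"
  assumes F5: "\<And>r p X. X \<in> sym_matrices \<Longrightarrow> r \<ge> 0 \<Longrightarrow> F r p X \<le> F 0 p X"
    and U: "open U" "U \<noteq> UNIV" and G: "condition_G F U"
  shows "viscosity_supersolution F (\<lambda>x. infdist x (- U))"
  unfolding viscosity_supersolution_def
proof (intro conjI allI impI)
  let ?v = "\<lambda>x. infdist x (- U)"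
  show "continuous_on UNIV ?v" by (intro continuous_intros)
  fix \<phi> :: "real^'n \<Rightarrow> real" and x
  assume \<phi>: "C2 \<phi>" and min: "\<forall>\<^sub>F z in nhds x. ?v x - \<phi> x \<le> ?v z - \<phi> z"
  have "closed (- U)" "- U \<noteq> {}" using U by auto
  \<comment> \<open>For \<open>x\<close> outside \<open>U\<close> the distance is 0 and thus
    \<open>y = x\<close>, so both positions of \<open>x\<close> are treated at once.\<close>
  then obtain y where y: "y \<in> - U" "?v x = dist x y"
    by (rule infdist_attains_inf)
  define \<psi> where "\<psi> = (\<lambda>z. \<phi> (z + (x - y)) - \<phi> x)"
  note \<psi> = C2_translate[OF \<phi>, of "x - y" "\<phi> x", folded \<psi>_def]
  have "filterlim (\<lambda>z. z + (x - y)) (nhds (y + (x - y))) (nhds y)"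
    by (intro tendsto_intros) (simp add: filterlim_ident)
  then have "filterlim (\<lambda>z. z + (x - y)) (nhds x) (nhds y)" by simp
  from eventually_compose_filterlim[OF min this]
  have max: "\<forall>\<^sub>F z in nhds y. z \<notin> U \<longrightarrow> \<psi> z \<le> 0"
  proof (rule eventually_mono, intro impI)
    fix z assume "?v x - \<phi> x \<le> ?v (z + (x - y)) - \<phi> (z + (x - y))" "z \<notin> U"
    \<comment> \<open>The point \<open>z\<close> lies outside \<open>U\<close> and so competes in
      the distance; the right-hand side equals \<open>dist x y\<close>, that is \<open>?v x\<close>.
      Minimality then bounds the increment of \<open>\<phi>\<close> by 0.\<close>
    moreover from this have "?v (z + (x - y)) \<le> dist (z + (x - y)) z"
      by (intro infdist_le) simp
    ultimately show "\<psi> z \<le> 0"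
      unfolding \<psi>_def using y(2) by (simp add: dist_norm)
  qed
  \<comment> \<open>(F5) passes from the height \<open>?v x\<close> to the height 0, the only one at
    which (G) gives information.\<close>
  have "F (?v x) (gradient \<phi> x) (hessian \<phi> x) \<le> F 0 (gradient \<phi> x) (hessian \<phi> x)"
    by (intro F5 hessian_symmetric \<phi> infdist_nonneg)
  also have "\<dots> = F 0 (gradient \<psi> y) (hessian \<psi> y)"
    unfolding \<psi>(2,3) by simp
  also have "\<dots> \<le> 0"
    using y(1) max by (intro condition_G_local[OF G \<psi>(1)]) (auto simp: \<psi>_def)
  finally show "F (?v x) (gradient \<phi> x) (hessian \<phi> x) \<le> 0" .
qed

section \<open>Constant supersolutions and the final case distinction\<close>

lemma zero_sym_matrices: "0 \<in> sym_matrices"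
  by (simp add: sym_matrices_def transpose_def vec_eq_iff)

text \<open>A test function touching a constant from below has a local maximum there, so its
  gradient vanishes and its Hessian is at most 0; (F2) then compares with
  \<open>F c 0 0\<close>.\<close>

lemma const_supersolution:
  fixes F :: "real \<Rightarrow> real^'n \<Rightarrow> real^'n^'n \<Rightarrow> real"
  assumes F2: "\<And>r p X Y. X \<in> sym_matrices \<Longrightarrow> Y \<in> sym_matrices \<Longrightarrow> sym_le X Y \<Longrightarrow>
      F r p X \<le> F r p Y"
    and c: "F c 0 0 \<le> 0"
  shows "viscosity_supersolution F (\<lambda>x. c)"
  unfolding viscosity_supersolution_def
proof (intro conjI allI impI)
  fix \<phi> :: "real^'n \<Rightarrow> real" and x
  assume \<phi>: "C2 \<phi>" and "\<forall>\<^sub>F y in nhds x. c - \<phi> x \<le> c - \<phi> y"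
  then have "gradient \<phi> x = 0" "sym_le (hessian \<phi> x) 0"
    using local_max_gradient_hessian[OF \<phi>] by simp_all
  then show "F c (gradient \<phi> x) (hessian \<phi> x) \<le> 0"
    using F2[OF hessian_symmetric[OF \<phi>] zero_sym_matrices, of x c 0] c by simp
qed (intro continuous_intros)

text \<open>For \<open>U = UNIV\<close> condition (G) is vacuous and the conclusion can fail: if
  \<open>F\<close> is constantly 1 and \<open>v\<close> is continuous and nonnegative, then
  \<open>v x + x \<bullet> x\<close> attains its minimum, so \<open>- (x \<bullet> x)\<close> is a
  test function at which the supersolution inequality is violated. The assumption
  \<open>whole_space\<close> excludes this.\<close>

theorem theorem3:
  fixes F :: "real \<Rightarrow> real^'n \<Rightarrow> real^'n^'n \<Rightarrow> real"
    and U :: "(real^'n) set"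
  assumes F1: "continuous_on (UNIV \<times> UNIV \<times> sym_matrices) (\<lambda>(r, p, X). F r p X)"
    and F2: "\<And>r p X Y. X \<in> sym_matrices \<Longrightarrow> Y \<in> sym_matrices \<Longrightarrow> sym_le X Y \<Longrightarrow>
      F r p X \<le> F r p Y"
    and F5: "\<And>r p X. X \<in> sym_matrices \<Longrightarrow> r \<ge> 0 \<Longrightarrow> F r p X \<le> F 0 p X"
    and U_open: "open U"
    and G: "condition_G F U"
    and whole_space: "U = UNIV \<Longrightarrow> F 0 0 0 \<le> 0"
  shows "\<exists>v. continuous_on UNIV v \<and> viscosity_supersolution F v \<and>
    (\<forall>x. v x \<ge> 0) \<and> U = {x. v x > 0}"
proof (cases "U = UNIV")
  case True
  have "F 1 0 0 \<le> 0"
    using F5[OF zero_sym_matrices, of 1 0] whole_space[OF True] by simp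
  have "viscosity_supersolution F (\<lambda>x. 1)"
  proof (rule const_supersolution)
    show "F r p X \<le> F r p Y" if "X \<in> sym_matrices" "Y \<in> sym_matrices" "sym_le X Y" for r p X Y
      using that by (rule F2)
  qed fact
  then show ?thesis
    using True by (intro exI[of _ "\<lambda>x. 1"]) auto
next
  case False
  \<comment> \<open>A nonempty complement is essential: \<open>infdist\<close> to the empty set is 0
    by definition, so for \<open>U = UNIV\<close> the distance would be positive nowhere.\<close>
  have "x \<in> U \<longleftrightarrow> infdist x (- U) > 0" for x
    using in_closed_iff_infdist_zero[of "- U" x] U_open False infdist_nonneg[of x "- U"]
    by (auto simp: less_le)
  then have "U = {x. infdist x (- U) > 0}" by auto
  moreover have "viscosity_supersolution F (\<lambda>x. infdist x (- U))"
    by (rule infdist_supersolution[OF F5 U_open False G])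
  moreover have "continuous_on UNIV (\<lambda>x. infdist x (- U))"
    by (intro continuous_intros)
  ultimately show ?thesis
    by (intro exI[of _ "\<lambda>x. infdist x (- U)"] conjI allI infdist_nonneg)
qed

end
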